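(* Let $\{X(t),t\ge0\}$ be an $H$-sssi stochastic process, let $T>0$, and let $d(h)$ denote the spectrum of singularities of its sample paths on $[0,T]$. If $\gamma<H$ and $d(\gamma)\neq-\infty$ (i.e. it is not the case that $d(\gamma)=-\infty$ almost surely), then $E|X(1)|^{q}=\infty$ for every $q>1/(H-\gamma)$.
   Context: All processes are real-valued, measurable, separable, not a.s. constant, and stochastically continuous at zero, i.e. $P(|X(h)|>\varepsilon)\to0$ as $h\to0$ for every $\varepsilon>0$. A process is $H$-sssi ($H\ge0$) if it is $H$-self-similar, i.e. for every $a>0$ the processes $\{X(at)\}$ and $\{a^HX(t)\}$ have the same finite dimensional distributions, and has stationary increments, i.e. for every $s\ge0$ the processes $\{X(s+t)-X(s)\}_{t\ge0}$ and $\{X(t)-X(0)\}_{t\ge0}$ have the same finite dimensional distributions. Pointwise Hölder exponent: $f\in C^{\gamma}(t_0)$ if there is $C>0$ such that $|f(t)-f(t_0)|\le C|t-t_0|^{\gamma}$ for all $t$ (in the domain of $f$) in some neighbourhood of $t_0$; $H(t_0)=\sup\{\gamma\ge 0: f\in C^{\gamma}(t_0)\}$ with $\sup\emptyset=0$. The spectrum $d(h)$ of a path on $[0,T]$ is the Hausdorff dimension of $S_h=\{t\in[0,T]:H(t)=h\}$, with $\dim_H\emptyset=-\infty$. Convention on modifications: if there is $q>0$ with $E|X(T)|^q<\infty$ and $Hq>1$, then $\{X(t),t\in[0,T]\}$ has, by the Kolmogorov–Chentsov theorem, a modification which is a.s. locally Hölder continuous with every exponent $\gamma\in(0,H-1/q)$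 for every such $q$; in that case $X$ always denotes this modification. *)

theory Defs
  imports "HOL-Probability.Probability"
begin

section \<open>Self-similar processes with stationary increments\<close>

text \<open>
  A process is a function \<open>X :: real \<Rightarrow> 'a \<Rightarrow> real\<close> of which only the values at times
  \<open>t \<ge> 0\<close> matter.
\<close>

definition same_fdd :: "'a measure \<Rightarrow> (real \<Rightarrow> 'a \<Rightarrow> real) \<Rightarrow> (real \<Rightarrow> 'a \<Rightarrow> real) \<Rightarrow> bool" where
  "same_fdd M X Y \<longleftrightarrow>
     (\<forall>I. finite I \<and> I \<subseteq> {0..} \<longrightarrow>
        distr M (Pi\<^sub>M I (\<lambda>_. borel)) (\<lambda>\<omega>. \<lambda>t\<in>I. X t \<omega>) =
        distr M (Pi\<^sub>M I (\<lambda>_. borel)) (\<lambda>\<omega>. \<lambda>t\<in>I. Y t \<omega>))"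

definition self_similar :: "'a measure \<Rightarrow> (real \<Rightarrow> 'a \<Rightarrow> real) \<Rightarrow> real \<Rightarrow> bool" where
  "self_similar M X H \<longleftrightarrow>
     (\<forall>a>0. same_fdd M (\<lambda>t. X (a * t)) (\<lambda>t \<omega>. a powr H * X t \<omega>))"

definition stationary_increments :: "'a measure \<Rightarrow> (real \<Rightarrow> 'a \<Rightarrow> real) \<Rightarrow> bool" where
  "stationary_increments M X \<longleftrightarrow>
     (\<forall>s\<ge>0. same_fdd M (\<lambda>t \<omega>. X (s + t) \<omega> - X s \<omega>) (\<lambda>t \<omega>. X t \<omega> - X 0 \<omega>))"

definition measurable_process :: "'a measure \<Rightarrow> (real \<Rightarrow> 'a \<Rightarrow> real) \<Rightarrow> bool" where
  "measurable_process M X \<longleftrightarrow>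
     (\<lambda>(t, \<omega>). X t \<omega>) \<in> borel_measurable (restrict_space borel {0..} \<Otimes>\<^sub>M M)"

text \<open>
  Separability in the sense of Doob. For real-valued processes the formulation by sequences
  used here is the same as the one by closed sets and open intervals.
\<close>

definition separable_process :: "'a measure \<Rightarrow> (real \<Rightarrow> 'a \<Rightarrow> real) \<Rightarrow> bool" where
  "separable_process M X \<longleftrightarrow>
     (\<exists>D. countable D \<and> D \<subseteq> {0..} \<and>
        (AE \<omega> in M. \<forall>t\<ge>0. \<exists>s. (\<forall>n. s n \<in> D) \<and> s \<longlonglongrightarrow> t \<and> (\<lambda>n. X (s n) \<omega>) \<longlonglongrightarrow> X t \<omega>))"

definition stochastically_continuous_at_zero ::
  "'a measure \<Rightarrow> (real \<Rightarrow> 'a \<Rightarrow> real) \<Rightarrow> bool" where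
  "stochastically_continuous_at_zero M X \<longleftrightarrow>
     (\<forall>\<epsilon>>0. ((\<lambda>h. measure M {\<omega> \<in> space M. \<bar>X h \<omega>\<bar> > \<epsilon>}) \<longlongrightarrow> 0) (at 0 within {0..}))"

text \<open>
  Non-degeneracy only excludes deterministic constants, which is the weakest reading of
  ``not a.s. constant''.
\<close>

locale sssi_process = prob_space M for M :: "'a measure" +
  fixes X :: "real \<Rightarrow> 'a \<Rightarrow> real" and H :: real
  assumes measurable: "measurable_process M X"
    and separable: "separable_process M X"
    and not_constant: "\<not> (\<exists>c. AE \<omega> in M. \<forall>t\<ge>0. X t \<omega> = c)"
    and stochastically_continuous: "stochastically_continuous_at_zero M X"
    and H_nonneg: "0 \<le> H"
    and self_similar: "self_similar M X H"
    and stationary_increments: "stationary_increments M X"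

definition abs_moment :: "'a measure \<Rightarrow> ('a \<Rightarrow> real) \<Rightarrow> real \<Rightarrow> ennreal" where
  "abs_moment M Z q = (\<integral>\<^sup>+ \<omega>. ennreal (\<bar>Z \<omega>\<bar> powr q) \<partial>M)"


section \<open>Hoelder regularity\<close>

definition locally_hoelder_on :: "real \<Rightarrow> real set \<Rightarrow> (real \<Rightarrow> real) \<Rightarrow> bool" where
  "locally_hoelder_on \<gamma> D f \<longleftrightarrow>
     (\<forall>t\<^sub>0\<in>D. \<exists>U C. open U \<and> t\<^sub>0 \<in> U \<and>
        (\<forall>s\<in>U \<inter> D. \<forall>t\<in>U \<inter> D. \<bar>f t - f s\<bar> \<le> C * \<bar>t - s\<bar> powr \<gamma>))"

text \<open>
  The convention that on \<open>{0..T}\<close> the process is taken to be its Kolmogorov--Chentsov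
  modification as soon as some moment of order \<open>q\<close> with \<open>H * q > 1\<close> is finite; if there is no
  such \<open>q\<close>, nothing is required.
\<close>

definition hoelder_modification_convention ::
  "'a measure \<Rightarrow> (real \<Rightarrow> 'a \<Rightarrow> real) \<Rightarrow> real \<Rightarrow> real \<Rightarrow> bool" where
  "hoelder_modification_convention M X H T \<longleftrightarrow>
     (AE \<omega> in M. \<forall>q>0. H * q > 1 \<and> abs_moment M (X T) q < \<infinity> \<longrightarrow>
        (\<forall>\<gamma>\<in>{0<..<H - 1 / q}. locally_hoelder_on \<gamma> {0..T} (\<lambda>t. X t \<omega>)))"

definition pointwise_hoelder :: "real \<Rightarrow> real set \<Rightarrow> (real \<Rightarrow> real) \<Rightarrow> real \<Rightarrow> bool" where
  "pointwise_hoelder \<gamma> D f t\<^sub>0 \<longleftrightarrow>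
     (\<exists>C>0. eventually (\<lambda>t. \<bar>f t - f t\<^sub>0\<bar> \<le> C * \<bar>t - t\<^sub>0\<bar> powr \<gamma>) (at t\<^sub>0 within D))"

text \<open>The explicit case distinction is needed since \<open>Sup {} = -\<infinity>\<close> in the extended reals.\<close>

definition hoelder_exponent :: "real set \<Rightarrow> (real \<Rightarrow> real) \<Rightarrow> real \<Rightarrow> ereal" where
  "hoelder_exponent D f t\<^sub>0 =
     (let \<Gamma> = {\<gamma>. 0 \<le> \<gamma> \<and> pointwise_hoelder \<gamma> D f t\<^sub>0}
      in if \<Gamma> = {} then 0 else (SUP \<gamma>\<in>\<Gamma>. ereal \<gamma>))"


section \<open>Hausdorff dimension and the spectrum of singularities\<close>

text \<open>
  \<open>diameter U powr s\<close> with the conventions \<open>diam {} ^ s = 0\<close> and \<open>diam U ^ 0 = 1\<close> for nonempty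
  \<open>U\<close>; the latter is not what \<open>0 powr 0 = 0\<close> gives for singletons.
\<close>

definition diameter_weight :: "real \<Rightarrow> 'a::metric_space set \<Rightarrow> ennreal" where
  "diameter_weight s U =
     (if U = {} then 0 else if s = 0 then 1 else ennreal (diameter U powr s))"

text \<open>Boundedness is required because \<open>diameter\<close> is meaningless on unbounded sets.\<close>

definition hausdorff_premeasure :: "real \<Rightarrow> real \<Rightarrow> 'a::metric_space set \<Rightarrow> ennreal" where
  "hausdorff_premeasure s \<delta> A =
     (INF U \<in> {U :: nat \<Rightarrow> 'a set. A \<subseteq> (\<Union>i. U i) \<and> (\<forall>i. bounded (U i) \<and> diameter (U i) \<le> \<delta>)}.
        \<Sum>i. diameter_weight s (U i))"

definition hausdorff_measure :: "real \<Rightarrow> 'a::metric_space set \<Rightarrow> ennreal" where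
  "hausdorff_measure s A = (SUP \<delta>\<in>{0<..}. hausdorff_premeasure s \<delta> A)"

definition hausdorff_dimension :: "'a::metric_space set \<Rightarrow> ereal" where
  "hausdorff_dimension A =
     (if A = {} then -\<infinity> else (INF s\<in>{s. 0 \<le> s \<and> hausdorff_measure s A = 0}. ereal s))"

definition singularity_spectrum :: "real \<Rightarrow> (real \<Rightarrow> real) \<Rightarrow> ereal \<Rightarrow> ereal" where
  "singularity_spectrum T f h = hausdorff_dimension {t \<in> {0..T}. hoelder_exponent {0..T} f t = h}"

end

theory Submission
  imports Defs
begin

text \<open>
  A finite moment of order \<open>q > 1 / (H - \<gamma>)\<close> of \<open>X 1\<close> passes to \<open>X T\<close> by self-similarity. Almost
  every path is then locally Hoelder with some exponent strictly between \<open>\<gamma>\<close> and \<open>H - 1 / q\<close>, so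
  its pointwise exponent exceeds \<open>\<gamma>\<close> everywhere and the level set of \<open>\<gamma>\<close> is empty.
\<close>

text \<open>Either the default value 0 applies or some nonnegative member of \<Gamma> bounds the
  supremum from below. This makes the level sets of negative \<gamma> empty.\<close>

lemma hoelder_exponent_nonneg: "0 \<le> hoelder_exponent D f t"
proof -
  define \<Gamma> where "\<Gamma> = {\<gamma>. 0 \<le> \<gamma> \<and> pointwise_hoelder \<gamma> D f t}"
  have "0 \<le> (SUP \<gamma>\<in>\<Gamma>. ereal \<gamma>)" if "\<gamma> \<in> \<Gamma>" for \<gamma>
    using that by (intro SUP_upper2[of \<gamma>]) (auto simp: \<Gamma>_def)
  then show ?thesis
    unfolding hoelder_exponent_def Let_def \<Gamma>_def[symmetric] by auto
qed

lemma hoelder_exponent_ge: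
  assumes "0 \<le> \<gamma>" "pointwise_hoelder \<gamma> D f t"
  shows "ereal \<gamma> \<le> hoelder_exponent D f t"
proof -
  have "\<gamma> \<in> {\<gamma>. 0 \<le> \<gamma> \<and> pointwise_hoelder \<gamma> D f t}"
    using assms by simp
  then show ?thesis
    unfolding hoelder_exponent_def Let_def by (auto intro: SUP_upper)
qed

text \<open>The two-point estimate on a neighbourhood of \<open>t\<^sub>0\<close> is specialised by
  freezing one of the points at \<open>t\<^sub>0\<close>.\<close>

lemma locally_hoelder_on_imp_pointwise_hoelder:
  assumes "locally_hoelder_on \<gamma> D f" "t\<^sub>0 \<in> D"
  shows "pointwise_hoelder \<gamma> D f t\<^sub>0"
proof -
  obtain U C where U: "open U" "t\<^sub>0 \<in> U"
    and C: "\<And>s t. s \<in> U \<inter> D \<Longrightarrow> t \<in> U \<inter> D \<Longrightarrow> \<bar>f t - f s\<bar> \<le> C * \<bar>t - s\<bar> powr \<gamma>"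
    using bspec[OF assms(1)[unfolded locally_hoelder_on_def] assms(2)] by (elim exE conjE) auto
  \<comment> \<open>The local constant \<open>C\<close> may be zero or negative, whereas the
    pointwise condition asks for a positive one; hence \<open>max C 1\<close>.\<close>
  have "\<bar>f t - f t\<^sub>0\<bar> \<le> max C 1 * \<bar>t - t\<^sub>0\<bar> powr \<gamma>" if "t \<in> U" "t \<in> D" for t
  proof -
    have "\<bar>f t - f t\<^sub>0\<bar> \<le> C * \<bar>t - t\<^sub>0\<bar> powr \<gamma>"
      using that U assms(2) by (intro C) auto
    also have "\<dots> \<le> max C 1 * \<bar>t - t\<^sub>0\<bar> powr \<gamma>"
      by (intro mult_right_mono) auto
    finally show ?thesis .
  qed
  then have "eventually (\<lambda>t. \<bar>f t - f t\<^sub>0\<bar> \<le> max C 1 * \<bar>t - t\<^sub>0\<bar> powr \<gamma>) (at t\<^sub>0 within D)"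
    using U unfolding eventually_at_topological by blast
  then show ?thesis
    unfolding pointwise_hoelder_def by (intro exI[of _ "max C 1"]) auto
qed

lemma singularity_spectrum_eq_minus_infinity:
  assumes "\<And>t. t \<in> {0..T} \<Longrightarrow> hoelder_exponent {0..T} f t \<noteq> h"
  shows "singularity_spectrum T f h = -\<infinity>"
  using assms by (auto simp: singularity_spectrum_def hausdorff_dimension_def)

lemma measurable_process_marginal:
  assumes "measurable_process M X" "0 \<le> t"
  shows "X t \<in> borel_measurable M"
proof -
  have "(\<lambda>\<omega>. (t, \<omega>)) \<in> M \<rightarrow>\<^sub>M restrict_space borel {0..} \<Otimes>\<^sub>M M"
    using assms(2) by (intro measurable_Pair) (auto simp: space_restrict_space)
  from measurable_compose[OF this assms(1)[unfolded measurable_process_def]]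
  show ?thesis by simp
qed

text \<open>An absolute moment is an integral against the one-dimensional law, so comparing the
  distributions over the index set \<open>{t}\<close> suffices.\<close>

lemma same_fdd_abs_moment_eq:
  assumes "same_fdd M X Y" "0 \<le> t" "X t \<in> borel_measurable M" "Y t \<in> borel_measurable M"
  shows "abs_moment M (X t) q = abs_moment M (Y t) q"
proof -
  let ?P = "Pi\<^sub>M {t} (\<lambda>_. borel :: real measure)"
  have distr: "distr M ?P (\<lambda>\<omega>. \<lambda>t\<in>{t}. X t \<omega>) = distr M ?P (\<lambda>\<omega>. \<lambda>t\<in>{t}. Y t \<omega>)"
    using assms(1,2) unfolding same_fdd_def by auto
  have moment: "abs_moment M (Z t) q =
      (\<integral>\<^sup>+ x. ennreal (\<bar>x t\<bar> powr q) \<partial>distr M ?P (\<lambda>\<omega>. \<lambda>t\<in>{t}. Z t \<omega>))"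
    if "Z t \<in> borel_measurable M" for Z :: "real \<Rightarrow> 'a \<Rightarrow> real"
  proof -
    have "(\<lambda>\<omega>. \<lambda>t\<in>{t}. Z t \<omega>) \<in> M \<rightarrow>\<^sub>M ?P"
      using that by (intro measurable_restrict) auto
    moreover have "(\<lambda>x. ennreal (\<bar>x t\<bar> powr q)) \<in> borel_measurable ?P"
      by measurable
    ultimately show ?thesis
      by (simp add: abs_moment_def nn_integral_distr)
  qed
  show ?thesis
    using moment[of X, OF assms(3)] moment[of Y, OF assms(4)] distr by simp
qed

lemma abs_moment_cmult:
  assumes "Z \<in> borel_measurable M"
  shows "abs_moment M (\<lambda>\<omega>. c * Z \<omega>) q = ennreal (\<bar>c\<bar> powr q) * abs_moment M Z q"
  using assms by (simp add: abs_moment_def abs_mult powr_mult ennreal_mult nn_integral_cmult)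

text \<open>By self-similarity \<open>X (a * t)\<close> has the law of
  \<open>a powr H * X t\<close>, and the deterministic factor leaves the integral.\<close>

lemma (in sssi_process) abs_moment_scale:
  assumes "0 < a" "0 \<le> t"
  shows "abs_moment M (X (a * t)) q = ennreal ((a powr H) powr q) * abs_moment M (X t) q"
proof -
  have meas: "X s \<in> borel_measurable M" if "0 \<le> s" for s
    using measurable_process_marginal[OF measurable that] .
  have "same_fdd M (\<lambda>t. X (a * t)) (\<lambda>t \<omega>. a powr H * X t \<omega>)"
    using self_similar assms(1) unfolding self_similar_def by blast
  from same_fdd_abs_moment_eq[OF this assms(2)] show ?thesis
    using assms meas by (simp add: abs_moment_cmult)
qed

theorem proposition3:
  fixes M :: "'a measure" and X :: "real \<Rightarrow> 'a \<Rightarrow> real" and H T \<gamma> :: real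
  assumes "sssi_process M X H"
    and "0 < T"
    and "hoelder_modification_convention M X H T"
    and "\<gamma> < H"
    and "\<not> (AE \<omega> in M. singularity_spectrum T (\<lambda>t. X t \<omega>) (ereal \<gamma>) = -\<infinity>)"
  shows "\<forall>q > 1 / (H - \<gamma>). abs_moment M (X 1) q = \<infinity>"
proof (intro allI impI, rule ccontr)
  fix q assume q: "q > 1 / (H - \<gamma>)" and "abs_moment M (X 1) q \<noteq> \<infinity>"
  then have fin1: "abs_moment M (X 1) q < \<infinity>"
    by (simp add: less_top)
  interpret sssi_process M X H by fact
  have "0 < 1 / (H - \<gamma>)" using assms(4) by simp
  with q have "0 < q" by linarith
  \<comment> \<open>A negative \<gamma> would contradict the nonempty level set. The sign is used
    twice below: to get \<open>H * q > 1\<close>, and to make the intermediate exponent positive as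
    the convention demands.\<close>
  have "0 \<le> \<gamma>"
  proof (rule ccontr)
    assume "\<not> 0 \<le> \<gamma>"
    then have "ereal \<gamma> < 0" by simp
    from less_le_trans[OF this hoelder_exponent_nonneg]
    have "hoelder_exponent D f t \<noteq> ereal \<gamma>" for D f t
      by (metis less_irrefl)
    then have "singularity_spectrum T (\<lambda>t. X t \<omega>) (ereal \<gamma>) = -\<infinity>" for \<omega>
      by (intro singularity_spectrum_eq_minus_infinity)
    with assms(5) show False by simp
  qed
  \<comment> \<open>This is the bound on \<open>q\<close> rearranged: \<gamma> lies strictly below
    the Kolmogorov-Chentsov threshold.\<close>
  have less: "\<gamma> < H - 1 / q"
    using q \<open>0 < q\<close> assms(4) by (simp add: field_simps)
  with \<open>0 \<le> \<gamma>\<close> have "1 / q < H" by linarith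
  then have Hq: "1 < H * q"
    using \<open>0 < q\<close> by (simp add: field_simps)
  \<comment> \<open>The convention concerns \<open>X T\<close>, so the moment is moved from time 1
    by scaling with \<open>a = T\<close>; the factor is finite.\<close>
  have finT: "abs_moment M (X T) q < \<infinity>"
    using abs_moment_scale[of T 1 q] fin1 assms(2) by (simp add: ennreal_mult_less_top)
  \<comment> \<open>Strictness on the left matters: regularity of order \<gamma> itself would still
    allow the exponent to equal \<gamma>.\<close>
  obtain \<beta> where \<beta>: "\<gamma> < \<beta>" "\<beta> < H - 1 / q"
    using dense[OF less] by blast
  have "AE \<omega> in M. locally_hoelder_on \<beta> {0..T} (\<lambda>t. X t \<omega>)"
    using assms(3) unfolding hoelder_modification_convention_def
  proof eventually_elim
    case (elim \<omega>)
    then show ?case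
      using \<open>0 < q\<close> Hq finT \<beta> \<open>0 \<le> \<gamma>\<close> by auto
  qed
  then have "AE \<omega> in M. singularity_spectrum T (\<lambda>t. X t \<omega>) (ereal \<gamma>) = -\<infinity>"
  proof eventually_elim
    case (elim \<omega>)
    show ?case
    proof (rule singularity_spectrum_eq_minus_infinity)
      fix t assume "t \<in> {0..T}"
      then have "ereal \<beta> \<le> hoelder_exponent {0..T} (\<lambda>t. X t \<omega>) t"
        using locally_hoelder_on_imp_pointwise_hoelder[OF elim] \<beta> \<open>0 \<le> \<gamma>\<close>
        by (intro hoelder_exponent_ge) auto
      with \<beta>(1) show "hoelder_exponent {0..T} (\<lambda>t. X t \<omega>) t \<noteq> ereal \<gamma>"
        by auto
    qed
  qed
  with assms(5) show False by simp
qed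

end
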